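(* Let $R = K[x_1,\ldots,x_n]$, let $K_n$ denote the complete graph on $\{x_1,\ldots,x_n\}$, and let $I = I(K_n)\subseteq R$ be its edge ideal. For every integer $t\ge 1$, let $(D(t))$ be the ideal of $R$ generated by $$D(t) = \{x^{\underline{a}} \mid \deg(x^{\underline{a}}) < 2t \text{ and } w_{V'}(x^{\underline{a}}) \ge t \text{ for all minimal vertex covers } V' \text{ of } K_n\}.$$ Then $I^{(t)} = I^t + (D(t))$.
   Context: $K$ is an algebraically closed field; vertices are identified with the variables of the polynomial ring. The edge ideal $I(G)$ of a simple graph $G$ is the ideal generated by all products $x_ix_j$ with $\{x_i,x_j\}$ an edge of $G$. The $m$th symbolic power of an ideal $I$ of a polynomial ring $S$ is $I^{(m)} = S\cap\bigcap_{P\in \mathrm{Ass}(I)} I^m S_P$. A vertex cover of $G$ is a set $V'$ of vertices meeting every edge; it is minimal if it is minimal with respect to inclusion. For a set $V'$ of vertices and a monomial $x^{\underline{a}} = \prod_i x_i^{a_i}$, the vertex weight is $w_{V'}(x^{\underline{a}}) = \sum_{x_i\in V'} a_i$. *)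

theory Defs
  imports
    "HOL-Library.Poly_Mapping"
    "HOL-Library.Set_Algebras"
    "HOL-Computational_Algebra.Computational_Algebra"
begin

text \<open>
  Ideals of a commutative ring are its submodules: with the interpretation below,
  \<open>ideal.subspace I\<close> says that \<open>I\<close> is an ideal and \<open>ideal.span B\<close> is the ideal generated by \<open>B\<close>.
\<close>

interpretation ideal: module "(*) :: 'a::comm_ring_1 \<Rightarrow> 'a \<Rightarrow> 'a"
  by unfold_locales (simp_all add: algebra_simps)

text \<open>
  The power \<open>I ^ m\<close> of the set \<open>I\<close> provided by \<open>Set_Algebras\<close> consists of the \<open>m\<close>-fold products
  only and is not an ideal in general. The sum of two ideals, in contrast, is the
  elementwise sum \<open>I + J\<close>.
\<close>

definition ideal_power :: "'a::comm_ring_1 set \<Rightarrow> nat \<Rightarrow> 'a set" where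
  "ideal_power I m = ideal.span {(\<Prod>i<m. f i) | f. \<forall>i<m. f i \<in> I}"

definition prime_ideal :: "'a::comm_ring_1 set \<Rightarrow> bool" where
  "prime_ideal P \<longleftrightarrow> ideal.subspace P \<and> P \<noteq> UNIV \<and> (\<forall>a b. a * b \<in> P \<longrightarrow> a \<in> P \<or> b \<in> P)"

text \<open>As usual, \<open>Ass(I)\<close> denotes the associated primes of the module \<open>S/I\<close>: the prime ideals
  that are the annihilator \<open>(I : f)\<close> of the class of some \<open>f\<close>.\<close>

definition Ass :: "'a::comm_ring_1 set \<Rightarrow> 'a set set" where
  "Ass I = {P. prime_ideal P \<and> (\<exists>f. P = {g. g * f \<in> I})}"

text \<open>The localization \<open>S\<^sub>P\<close> of a domain \<open>S\<close> at a prime ideal \<open>P\<close>, as a subring of the fraction field,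
  in which \<open>S\<close> is embedded by \<open>to_fract\<close>.\<close>

definition localization :: "'a::idom set \<Rightarrow> 'a fract set" where
  "localization P = {Fract a s | a s. s \<notin> P}"

text \<open>The extension \<open>J S\<^sub>P\<close>, i.e. the ideal of \<open>S\<^sub>P\<close> generated by the image of \<open>J\<close>.\<close>

definition extension :: "'a::idom set \<Rightarrow> 'a set \<Rightarrow> 'a fract set" where
  "extension J P =
     {(\<Sum>x\<in>T. c x * to_fract x) | T c. finite T \<and> T \<subseteq> J \<and> (\<forall>x\<in>T. c x \<in> localization P)}"

definition symbolic_power :: "'a::idom set \<Rightarrow> nat \<Rightarrow> 'a set" where
  "symbolic_power I m = {f. \<forall>P\<in>Ass I. to_fract f \<in> extension (ideal_power I m) P}"

text \<open>
  The polynomial ring over \<open>'k\<close> with one variable for each element of \<open>'v\<close>; a polynomial maps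
  exponent vectors to coefficients. Below, \<open>'v\<close> is a finite linearly ordered type
  \<open>x\<^sub>1 < \<dots> < x\<^sub>n\<close>; the order only serves the instance of class \<open>idom\<close>.
\<close>

type_synonym ('v, 'k) mpoly = "('v \<Rightarrow>\<^sub>0 nat) \<Rightarrow>\<^sub>0 'k"

definition monomial :: "('v \<Rightarrow>\<^sub>0 nat) \<Rightarrow> ('v, 'k::zero_neq_one) mpoly" where
  "monomial a = Poly_Mapping.single a 1"

definition var :: "'v \<Rightarrow> ('v, 'k::zero_neq_one) mpoly" where
  "var v = monomial (Poly_Mapping.single v 1)"

definition mon_degree :: "('v::finite \<Rightarrow>\<^sub>0 nat) \<Rightarrow> nat" where
  "mon_degree a = (\<Sum>v\<in>UNIV. Poly_Mapping.lookup a v)"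

definition vertex_weight :: "'v set \<Rightarrow> ('v \<Rightarrow>\<^sub>0 nat) \<Rightarrow> nat" where
  "vertex_weight C a = (\<Sum>v\<in>C. Poly_Mapping.lookup a v)"

text \<open>A simple graph on the vertex set \<open>UNIV :: 'v set\<close> is given by its set of edges, each of
  which is a set of two distinct vertices.\<close>

definition complete_graph :: "'v set set" where
  "complete_graph = {{u, v} | u v. u \<noteq> v}"

definition edge_ideal :: "'v set set \<Rightarrow> ('v, 'k::comm_ring_1) mpoly set" where
  "edge_ideal E = ideal.span {var u * var v | u v. {u, v} \<in> E}"

definition vertex_cover :: "'v set set \<Rightarrow> 'v set \<Rightarrow> bool" where
  "vertex_cover E C \<longleftrightarrow> (\<forall>e\<in>E. e \<inter> C \<noteq> {})"

definition minimal_vertex_cover :: "'v set set \<Rightarrow> 'v set \<Rightarrow> bool" where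
  "minimal_vertex_cover E C \<longleftrightarrow> vertex_cover E C \<and> (\<forall>C'. C' \<subset> C \<longrightarrow> \<not> vertex_cover E C')"

definition D_set :: "'v::finite set set \<Rightarrow> nat \<Rightarrow> ('v, 'k::zero_neq_one) mpoly set" where
  "D_set E t = {monomial a | a. mon_degree a < 2 * t \<and>
     (\<forall>C. minimal_vertex_cover E C \<longrightarrow> vertex_weight C a \<ge> t)}"

end

theory Submission
  imports Defs
begin

text \<open>
  Write \<open>P\<^sub>v = (x\<^sub>u | u \<noteq> v)\<close>. Since \<open>I\<close> is spanned by the monomials with at least two variables,
  \<open>P\<^sub>v = (I : x\<^sub>v)\<close> is an associated prime, and its power \<open>P\<^sub>v\<^sup>t\<close>, spanned by the monomials of
  weight at least \<open>t\<close> outside \<open>v\<close>, is primary. Hence the monomials of any \<open>f \<in> I\<^sup>(\<^sup>t\<^sup>)\<close> satisfy all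
  weight conditions. Those of degree less than \<open>2t\<close> lie in \<open>D(t)\<close>, and the others lie in \<open>I\<^sup>t\<close>:
  repeatedly split off the edge that joins two vertices of largest exponents.
  Conversely, any associated prime avoids some variable \<open>x\<^sub>v\<close>, and multiplication by \<open>x\<^sub>v\<^sup>2\<^sup>t\<close> moves
  \<open>D(t)\<close> into \<open>I\<^sup>t\<close>.
\<close>

text \<open>This instance of \<open>scale_scale\<close> reverses associativity of multiplication and makes
  \<open>algebra_simps\<close> loop.\<close>

declare ideal.scale_scale [simp del]

section \<open>Localization at a prime ideal\<close>

lemma prime_idealD:
  assumes "prime_ideal P"
  shows "1 \<notin> P" and "0 \<in> P" and "a * b \<in> P \<Longrightarrow> a \<in> P \<or> b \<in> P"
proof -
  have P: "ideal.subspace P" "P \<noteq> UNIV" using assms by (auto simp: prime_ideal_def)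
  show "1 \<notin> P"
  proof
    assume "1 \<in> P"
    then have "x * 1 \<in> P" for x by (rule ideal.subspace_scale[OF P(1)])
    then show False using P(2) by auto
  qed
  show "0 \<in> P" using P(1) by (rule ideal.subspace_0)
  show "a * b \<in> P \<Longrightarrow> a \<in> P \<or> b \<in> P" using assms by (auto simp: prime_ideal_def)
qed

lemma prime_ideal_power:
  assumes "prime_ideal P" "a \<notin> P"
  shows "a ^ n \<notin> P"
proof (induction n)
  case 0
  show ?case using prime_idealD(1)[OF assms(1)] by simp
next
  case (Suc n)
  then show ?case using prime_idealD(3)[OF assms(1), of a "a ^ n"] assms(2) by auto
qed

text \<open>The denominators of the finitely many coefficients are multiplied up one at a time; the
  product stays outside \<open>P\<close> because \<open>P\<close> is prime.\<close>

lemma common_denominator: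
  assumes "prime_ideal P" "ideal.subspace J" "finite T" "T \<subseteq> J"
    and "\<forall>x\<in>T. c x \<in> localization P"
  shows "\<exists>s b. s \<notin> P \<and> b \<in> J \<and> to_fract s * (\<Sum>x\<in>T. c x * to_fract x) = to_fract b"
  using assms(3-)
proof (induction T rule: finite_induct)
  case empty
  show ?case
    using prime_idealD(1)[OF assms(1)] ideal.subspace_0[OF assms(2)]
    by (intro exI[of _ 1] exI[of _ 0]) auto
next
  case (insert x T)
  then obtain s b where sb: "s \<notin> P" "b \<in> J"
    "to_fract s * (\<Sum>x\<in>T. c x * to_fract x) = to_fract b" by auto
  obtain a r where r: "c x = Fract a r" "r \<notin> P"
    using insert.prems by (auto simp: localization_def)
  have "r \<noteq> 0" using r(2) prime_idealD(2)[OF assms(1)] by auto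
  then have cr: "to_fract r * c x = to_fract a"
    by (simp add: r to_fract_def eq_fract)
  have "r * s \<notin> P" using prime_idealD(3)[OF assms(1)] sb(1) r(2) by blast
  moreover have "s * a * x + r * b \<in> J"
    using insert.prems sb(2)
    by (intro ideal.subspace_add[OF assms(2)] ideal.subspace_scale[OF assms(2)]) auto
  moreover have "to_fract (r * s) * (\<Sum>x\<in>insert x T. c x * to_fract x)
     = to_fract s * (to_fract r * c x) * to_fract x
       + to_fract r * (to_fract s * (\<Sum>x\<in>T. c x * to_fract x))"
    using insert.hyps by (simp add: algebra_simps)
  then have "to_fract (r * s) * (\<Sum>x\<in>insert x T. c x * to_fract x) = to_fract (s * a * x + r * b)"
    by (simp add: sb cr)
  ultimately show ?case by blast
qed

text \<open>Clearing denominators turns membership in the extended ideal into a condition inside the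
  ring; fractions are needed only to reach this criterion.\<close>

lemma to_fract_in_extension_iff:
  assumes "prime_ideal P" "ideal.subspace J"
  shows "to_fract f \<in> extension J P \<longleftrightarrow> (\<exists>s. s \<notin> P \<and> s * f \<in> J)"
proof
  assume "to_fract f \<in> extension J P"
  then obtain T c where "finite T" "T \<subseteq> J" "\<forall>x\<in>T. c x \<in> localization P"
    and f: "to_fract f = (\<Sum>x\<in>T. c x * to_fract x)"
    unfolding extension_def by blast
  then obtain s b where "s \<notin> P" "b \<in> J" "to_fract s * to_fract f = to_fract b"
    using common_denominator[OF assms] unfolding f by blast
  then show "\<exists>s. s \<notin> P \<and> s * f \<in> J"
    by (metis to_fract_mult to_fract_eq_iff)
next
  assume "\<exists>s. s \<notin> P \<and> s * f \<in> J"
  then obtain s where s: "s \<notin> P" "s * f \<in> J" by blast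
  have "s \<noteq> 0" using s(1) prime_idealD(2)[OF assms(1)] by auto
  then have "to_fract f = Fract 1 s * to_fract (s * f)"
    by (simp add: to_fract_def eq_fract)
  moreover have "Fract 1 s \<in> localization P" using s(1) by (auto simp: localization_def)
  ultimately show "to_fract f \<in> extension J P"
    unfolding extension_def using s(2)
    by (intro CollectI exI[of _ "{s * f}"] exI[of _ "\<lambda>_. Fract 1 s"]) auto
qed

text \<open>This set is the contraction of the extension of \<open>J\<close>. Closure under sums
  uses the product of the two multipliers, which avoids \<open>P\<close> by primality.\<close>

lemma subspace_saturation:
  assumes "prime_ideal P" "ideal.subspace J"
  shows "ideal.subspace {f. \<exists>s. s \<notin> P \<and> s * f \<in> J}"
proof (rule ideal.subspaceI)
  show "0 \<in> {f. \<exists>s. s \<notin> P \<and> s * f \<in> J}"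
    using prime_idealD(1)[OF assms(1)] ideal.subspace_0[OF assms(2)] by auto
next
  fix f g
  assume "f \<in> {f. \<exists>s. s \<notin> P \<and> s * f \<in> J}" "g \<in> {f. \<exists>s. s \<notin> P \<and> s * f \<in> J}"
  then obtain r s where "r \<notin> P" "r * f \<in> J" "s \<notin> P" "s * g \<in> J" by blast
  moreover from this have "s * (r * f) + r * (s * g) \<in> J"
    by (blast intro: ideal.subspace_add[OF assms(2)] ideal.subspace_scale[OF assms(2)])
  moreover have "s * (r * f) + r * (s * g) = (r * s) * (f + g)"
    by (simp add: algebra_simps)
  ultimately show "f + g \<in> {f. \<exists>s. s \<notin> P \<and> s * f \<in> J}"
    using prime_idealD(3)[OF assms(1)] by (metis (mono_tags, lifting) mem_Collect_eq)
next
  fix c f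
  assume "f \<in> {f. \<exists>s. s \<notin> P \<and> s * f \<in> J}"
  then obtain s where "s \<notin> P" "s * f \<in> J" by blast
  moreover from this have "c * (s * f) \<in> J" by (blast intro: ideal.subspace_scale[OF assms(2)])
  ultimately show "c * f \<in> {f. \<exists>s. s \<notin> P \<and> s * f \<in> J}"
    by (auto simp: mult.left_commute)
qed

section \<open>Powers of ideals\<close>

lemma subspace_ideal_power: "ideal.subspace (ideal_power I m)"
  by (simp add: ideal_power_def)

lemma ideal_power_0: "ideal_power I 0 = UNIV"
proof -
  have "x * 1 \<in> ideal_power I 0" for x
    unfolding ideal_power_def by (intro ideal.span_scale ideal.span_base) auto
  then show ?thesis by auto
qed

text \<open>On a generator, \<open>x\<close> is appended as the factor of index \<open>m\<close>;
  linearity carries this over to the span.\<close>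

lemma mult_in_ideal_power_Suc:
  assumes "x \<in> I" "y \<in> ideal_power I m"
  shows "x * y \<in> ideal_power I (Suc m)"
  using assms(2) unfolding ideal_power_def
proof (induction y rule: ideal.span_induct_alt)
  case base
  show ?case by (simp add: ideal.span_zero)
next
  case (step c p z)
  then obtain f where f: "p = (\<Prod>i<m. f i)" "\<forall>i<m. f i \<in> I" by blast
  have "(\<Prod>i<Suc m. (f(m := x)) i) = p * x"
    by (simp add: f(1))
  then have "x * p \<in> {(\<Prod>i<Suc m. f i) | f. \<forall>i<Suc m. f i \<in> I}"
    using f(2) assms(1) by (intro CollectI exI[of _ "f(m := x)"]) (auto simp: mult.commute)
  then have "c * (x * p) + x * z \<in> ideal.span {(\<Prod>i<Suc m. f i) | f. \<forall>i<Suc m. f i \<in> I}"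
    by (intro ideal.span_add ideal.span_scale ideal.span_base step)
  then show ?case by (simp add: algebra_simps)
qed

section \<open>Monomial ideals\<close>

text \<open>The hypothesis makes \<open>U\<close> stable under multiplication by monomials, and sums
  and products create no exponents beyond those of the summands and the sums of those of the
  factors.\<close>

lemma subspace_keys:
  assumes "\<And>a b. U b \<Longrightarrow> U (a + b)"
  shows "ideal.subspace {f :: ('v, 'k::comm_ring_1) mpoly. \<forall>a\<in>Poly_Mapping.keys f. U a}"
proof (rule ideal.subspaceI)
  fix c f :: "('v, 'k) mpoly"
  assume "f \<in> {f. \<forall>a\<in>Poly_Mapping.keys f. U a}"
  then show "c * f \<in> {f. \<forall>a\<in>Poly_Mapping.keys f. U a}"
    using keys_mult[of c f] assms by blast
next
  fix f g :: "('v, 'k) mpoly"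
  assume "f \<in> {f. \<forall>a\<in>Poly_Mapping.keys f. U a}" "g \<in> {f. \<forall>a\<in>Poly_Mapping.keys f. U a}"
  then show "f + g \<in> {f. \<forall>a\<in>Poly_Mapping.keys f. U a}"
    using Poly_Mapping.keys_add[of f g] by blast
qed simp

lemma keys_monomial [simp]: "Poly_Mapping.keys (monomial a :: ('v, 'k::zero_neq_one) mpoly) = {a}"
  by (simp add: monomial_def)

lemma monomial_mult:
  "monomial a * monomial b = (monomial (a + b) :: ('v, 'k::comm_ring_1) mpoly)"
  by (simp add: monomial_def mult_single)

lemma keys_mult_monomial:
  fixes f :: "('v, 'k::comm_ring_1) mpoly"
  shows "Poly_Mapping.keys (f * monomial a) = (\<lambda>b. b + a) ` Poly_Mapping.keys f"
proof
  show "Poly_Mapping.keys (f * monomial a) \<subseteq> (\<lambda>b. b + a) ` Poly_Mapping.keys f"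
    using keys_mult[of f "monomial a"] by auto
  have "Poly_Mapping.lookup (f * monomial a) (b + a) = Poly_Mapping.lookup f b" for b
  proof -
    have "((1::'k) when a = q when b + a = c + q) = ((1 when c = b) when a = q)" for c q
      by (auto simp: when_def)
    then show ?thesis
      by (simp add: monomial_def lookup_mult lookup_single mult_when)
  qed
  then show "(\<lambda>b. b + a) ` Poly_Mapping.keys f \<subseteq> Poly_Mapping.keys (f * monomial a)"
    by (auto simp: in_keys_iff)
qed

lemma poly_mapping_eq_sum_monomials:
  fixes f :: "('v, 'k::comm_ring_1) mpoly"
  shows "f = (\<Sum>a\<in>Poly_Mapping.keys f. Poly_Mapping.single 0 (Poly_Mapping.lookup f a) * monomial a)"
proof (rule poly_mapping_eqI)
  fix b
  have "(\<Sum>a\<in>Poly_Mapping.keys f. Poly_Mapping.lookup f a when a = b) = Poly_Mapping.lookup f b"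
    by (simp add: when_def in_keys_iff)
  then show "Poly_Mapping.lookup f b = Poly_Mapping.lookup (\<Sum>a\<in>Poly_Mapping.keys f.
      Poly_Mapping.single 0 (Poly_Mapping.lookup f a) * monomial a) b"
    by (simp add: lookup_sum monomial_def mult_single lookup_single)
qed

text \<open>Coefficients are themselves ring elements, so \<open>f\<close> is a combination of its
  monomials with coefficients in the polynomial ring.\<close>

lemma mem_subspace_if_monomials:
  fixes f :: "('v, 'k::comm_ring_1) mpoly"
  assumes "ideal.subspace J" "\<And>a. a \<in> Poly_Mapping.keys f \<Longrightarrow> monomial a \<in> J"
  shows "f \<in> J"
  by (subst poly_mapping_eq_sum_monomials, rule ideal.subspace_sum[OF assms(1)],
      rule ideal.subspace_scale[OF assms(1)], rule assms(2))

text \<open>The components of least weight of \<open>s\<close> and \<open>f\<close> have a nonzero product, which no other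
  product of homogeneous components can cancel.\<close>

lemma weight_cancel:
  fixes s f :: "('v::linorder, 'k::idom) mpoly" and w :: "('v \<Rightarrow>\<^sub>0 nat) \<Rightarrow> nat"
  assumes w: "\<And>a b. w (a + b) = w a + w b"
    and s: "b \<in> Poly_Mapping.keys s" "w b = 0"
    and sf: "\<forall>a\<in>Poly_Mapping.keys (s * f). t \<le> w a"
  shows "\<forall>a\<in>Poly_Mapping.keys f. t \<le> w a"
proof (rule ccontr)
  assume "\<not> ?thesis"
  then obtain a0 where a0: "a0 \<in> Poly_Mapping.keys f" "w a0 < t" by auto
  define p where "p = (LEAST n. \<exists>a\<in>Poly_Mapping.keys f. w a = n)"
  have "\<exists>a\<in>Poly_Mapping.keys f. w a = p"
    unfolding p_def by (rule LeastI_ex) (use a0 in blast)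
  then obtain a where a: "a \<in> Poly_Mapping.keys f" "w a = p" by blast
  have p_le: "p \<le> w c" if "c \<in> Poly_Mapping.keys f" for c
    unfolding p_def by (rule Least_le) (use that in blast)
  have "p < t" using p_le[OF a0(1)] a0(2) by simp
  \<comment> \<open>\<open>part g n\<close> is the homogeneous component of \<open>g\<close> of
    weight \<open>n\<close>.\<close>
  define part where "part = (\<lambda>(g :: ('v, 'k) mpoly) n.
    Poly_Mapping.mapp (\<lambda>c x. if w c = n then x else 0) g)"
  have lookup_part: "Poly_Mapping.lookup (part g n) c
      = (if w c = n then Poly_Mapping.lookup g c else 0)" for g n c
    by (auto simp: part_def lookup_mapp when_def in_keys_iff)
  define f' where "f' = f - part f p"
  define s' where "s' = s - part s 0"
  have f': "p < w c" if "c \<in> Poly_Mapping.keys f'" for c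
  proof -
    have "w c \<noteq> p" "c \<in> Poly_Mapping.keys f"
      using that by (auto simp: in_keys_iff f'_def lookup_minus lookup_part split: if_splits)
    with p_le[of c] show ?thesis by simp
  qed
  have s': "0 < w c" if "c \<in> Poly_Mapping.keys s'" for c
    using that by (auto simp: in_keys_iff s'_def lookup_minus lookup_part split: if_splits)
  have keys_part: "w c = n" if "c \<in> Poly_Mapping.keys (part g n)" for c g n
    using that by (auto simp: in_keys_iff lookup_part split: if_splits)
  have "part f p \<noteq> 0" "part s 0 \<noteq> 0"
    using a s lookup_part[of f p a] lookup_part[of s 0 b] by (auto simp: in_keys_iff)
  then have "part s 0 * part f p \<noteq> 0" by simp
  then obtain c where c: "c \<in> Poly_Mapping.keys (part s 0 * part f p)"
    by (metis keys_eq_empty ex_in_conv)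
  have wc: "w c = p"
    using c keys_mult[of "part s 0" "part f p"] by (auto simp: w dest!: keys_part)
  \<comment> \<open>All monomials of \<open>f'\<close> have weight above \<open>p\<close> and all
    those of \<open>s'\<close> have positive weight, so neither remaining product reaches weight
    \<open>p\<close>.\<close>
  have "c \<notin> Poly_Mapping.keys (part s 0 * f')"
    using wc keys_mult[of "part s 0" f'] by (auto simp: w dest!: f')
  moreover have "c \<notin> Poly_Mapping.keys (s' * f)"
    using wc keys_mult[of s' f] by (auto simp: w dest!: s' p_le)
  moreover have "s * f = part s 0 * part f p + part s 0 * f' + s' * f"
    by (simp add: f'_def s'_def algebra_simps)
  ultimately have "c \<in> Poly_Mapping.keys (s * f)"
    using c by (simp add: in_keys_iff lookup_add)
  then show False using sf wc \<open>p < t\<close> by auto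
qed

section \<open>Ideals given by a weight condition\<close>

text \<open>For finite \<open>C\<close> this is the \<open>t\<close>-th power of the prime ideal
  generated by the variables in \<open>C\<close>; describing it by exponents makes membership a test
  on monomials.\<close>

definition weight_ideal :: "'v set \<Rightarrow> nat \<Rightarrow> ('v, 'k::comm_ring_1) mpoly set" where
  "weight_ideal C t = {f. \<forall>a\<in>Poly_Mapping.keys f. t \<le> vertex_weight C a}"

lemma vertex_weight_add: "vertex_weight C (a + b) = vertex_weight C a + vertex_weight C b"
  by (simp add: vertex_weight_def lookup_add sum.distrib)

lemma vertex_weight_single:
  fixes v :: "'v::finite"
  shows "vertex_weight C (Poly_Mapping.single v n) = (if v \<in> C then n else 0)"
  by (simp add: vertex_weight_def lookup_single when_def)

lemma mon_degree_eq: "mon_degree a = vertex_weight UNIV a"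
  by (simp add: mon_degree_def vertex_weight_def)

lemma mon_degree_split: "mon_degree a = Poly_Mapping.lookup a v + vertex_weight (- {v}) a"
  unfolding mon_degree_def vertex_weight_def by (subst sum.remove[of _ v]) (auto simp: Compl_eq_Diff_UNIV)

lemma subspace_weight_ideal: "ideal.subspace (weight_ideal C t)"
  unfolding weight_ideal_def by (rule subspace_keys) (simp add: vertex_weight_add)

lemma weight_ideal_mult:
  assumes "f \<in> weight_ideal C m" "g \<in> weight_ideal C n"
  shows "f * g \<in> weight_ideal C (m + n)"
  unfolding weight_ideal_def
proof clarify
  fix c assume "c \<in> Poly_Mapping.keys (f * g)"
  then obtain a b where "c = a + b" "a \<in> Poly_Mapping.keys f" "b \<in> Poly_Mapping.keys g"
    using keys_mult[of f g] by blast
  then show "m + n \<le> vertex_weight C c"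
    using assms by (auto simp: weight_ideal_def vertex_weight_add intro: add_mono)
qed

lemma ideal_power_subset_weight_ideal:
  fixes I :: "('v, 'k::comm_ring_1) mpoly set"
  assumes "I \<subseteq> weight_ideal C 1"
  shows "ideal_power I m \<subseteq> weight_ideal C m"
  unfolding ideal_power_def
proof (rule ideal.span_minimal[OF _ subspace_weight_ideal], clarify)
  fix f :: "nat \<Rightarrow> ('v, 'k) mpoly"
  assume "\<forall>i<m. f i \<in> I"
  then show "(\<Prod>i<m. f i) \<in> weight_ideal C m"
  proof (induction m)
    case 0
    show ?case by (simp add: weight_ideal_def)
  next
    case (Suc m)
    then have "(\<Prod>i<m. f i) * f m \<in> weight_ideal C (m + 1)"
      using assms by (intro weight_ideal_mult) auto
    then show ?case by simp
  qed
qed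

text \<open>An element outside \<open>weight_ideal C 1\<close> has a monomial of weight 0, so
  \<open>weight_cancel\<close> applies. Hence localizing at that prime and contracting does not
  enlarge \<open>weight_ideal C t\<close>.\<close>

lemma weight_ideal_cancel:
  fixes s f :: "('v::linorder, 'k::idom) mpoly"
  assumes "s * f \<in> weight_ideal C t" "s \<notin> weight_ideal C 1"
  shows "f \<in> weight_ideal C t"
proof -
  obtain b where "b \<in> Poly_Mapping.keys s" "vertex_weight C b = 0"
    using assms(2) by (auto simp: weight_ideal_def)
  then show ?thesis
    using assms(1) weight_cancel[of "vertex_weight C" b s f t]
    by (auto simp: weight_ideal_def vertex_weight_add)
qed

text \<open>Primality is the case \<open>t = 1\<close> of the cancellation property; properness
  holds because the exponent of 1 has weight 0.\<close>

lemma prime_weight_ideal: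
  "prime_ideal (weight_ideal C 1 :: ('v::linorder, 'k::idom) mpoly set)"
proof -
  have "(1 :: ('v, 'k) mpoly) \<notin> weight_ideal C 1"
    by (auto simp: weight_ideal_def vertex_weight_def)
  then show ?thesis
    unfolding prime_ideal_def using subspace_weight_ideal weight_ideal_cancel by blast
qed

section \<open>The edge ideal of the complete graph\<close>

lemma var_mult_var:
  "var u * var w = (monomial (Poly_Mapping.single u 1 + Poly_Mapping.single w 1) :: ('v, 'k::comm_ring_1) mpoly)"
  by (simp add: var_def monomial_mult)

lemma var_power: "(var v :: ('v, 'k::comm_ring_1) mpoly) ^ n = monomial (Poly_Mapping.single v n)"
proof (induction n)
  case 0
  show ?case by (simp add: monomial_def)
next
  case (Suc n)
  then show ?case by (simp add: var_def monomial_mult single_add[symmetric])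
qed

lemma split_two_variables:
  fixes a :: "'v \<Rightarrow>\<^sub>0 nat"
  assumes "u \<noteq> w" "Poly_Mapping.lookup a u \<noteq> 0" "Poly_Mapping.lookup a w \<noteq> 0"
  obtains b where "a = (Poly_Mapping.single u 1 + Poly_Mapping.single w 1) + b"
proof
  show "a = (Poly_Mapping.single u 1 + Poly_Mapping.single w 1)
      + (a - (Poly_Mapping.single u 1 + Poly_Mapping.single w 1))"
    \<comment> \<open>Subtraction of exponents is truncated; it is exact here because
      \<open>u\<close> and \<open>w\<close> differ, so each positive exponent drops by at most
      one.\<close>
    using assms by (intro poly_mapping_eqI) (auto simp: lookup_add lookup_minus lookup_single when_def)
qed

lemma edge_in_edge_ideal:
  "u \<noteq> w \<Longrightarrow> var u * var w \<in> (edge_ideal complete_graph :: ('v, 'k::comm_ring_1) mpoly set)"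
  unfolding edge_ideal_def complete_graph_def by (rule ideal.span_base) blast

text \<open>Every pair of distinct vertices is an edge, so a monomial is divisible by an edge
  exactly when two variables occur in it.\<close>

lemma edge_ideal_complete_graph:
  "(edge_ideal complete_graph :: ('v, 'k::comm_ring_1) mpoly set)
   = {f. \<forall>a\<in>Poly_Mapping.keys f. \<exists>u w. u \<noteq> w \<and> Poly_Mapping.lookup a u \<noteq> 0 \<and> Poly_Mapping.lookup a w \<noteq> 0}"
    (is "_ = ?J")
proof
  have "ideal.subspace ?J"
    by (rule subspace_keys) (auto simp: lookup_add)
  moreover have "{var u * var w | u w. {u, w} \<in> complete_graph} \<subseteq> ?J"
  proof clarify
    fix u w a
    assume "{u, w} \<in> complete_graph" and a: "a \<in> Poly_Mapping.keys (var u * var w :: ('v, 'k) mpoly)"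
    then have "u \<noteq> w" by (auto simp: complete_graph_def doubleton_eq_iff)
    with a show "\<exists>u w. u \<noteq> w \<and> Poly_Mapping.lookup a u \<noteq> 0 \<and> Poly_Mapping.lookup a w \<noteq> 0"
      by (intro exI[of _ u] exI[of _ w]) (auto simp: var_mult_var lookup_add)
  qed
  ultimately show "edge_ideal complete_graph \<subseteq> ?J"
    unfolding edge_ideal_def by (intro ideal.span_minimal)
  show "?J \<subseteq> edge_ideal complete_graph"
  proof
    fix f :: "('v, 'k) mpoly" assume f: "f \<in> ?J"
    have sub: "ideal.subspace (edge_ideal complete_graph :: ('v, 'k) mpoly set)"
      by (simp add: edge_ideal_def)
    show "f \<in> edge_ideal complete_graph"
    proof (rule mem_subspace_if_monomials[OF sub])
      fix a assume "a \<in> Poly_Mapping.keys f"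
      then obtain u w where uw: "u \<noteq> w" "Poly_Mapping.lookup a u \<noteq> 0" "Poly_Mapping.lookup a w \<noteq> 0"
        using f by blast
      then obtain b where "a = (Poly_Mapping.single u 1 + Poly_Mapping.single w 1) + b"
        by (rule split_two_variables)
      then have "monomial a = monomial b * (var u * var w :: ('v, 'k) mpoly)"
        by (simp add: var_mult_var monomial_mult add.commute)
      also have "\<dots> \<in> edge_ideal complete_graph"
        by (intro ideal.subspace_scale[OF sub] edge_in_edge_ideal uw)
      finally show "(monomial a :: ('v, 'k) mpoly) \<in> edge_ideal complete_graph" .
    qed
  qed
qed

text \<open>Of two distinct vertices in the support, at least one differs from
  \<open>v\<close>.\<close>

lemma edge_ideal_subset_weight_ideal:
  "(edge_ideal complete_graph :: ('v::finite, 'k::comm_ring_1) mpoly set) \<subseteq> weight_ideal (- {v}) 1"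
proof
  fix f :: "('v, 'k) mpoly"
  assume f: "f \<in> edge_ideal complete_graph"
  show "f \<in> weight_ideal (- {v}) 1"
    unfolding weight_ideal_def
  proof clarify
    fix a assume "a \<in> Poly_Mapping.keys f"
    then obtain p q where "p \<noteq> q" "Poly_Mapping.lookup a p \<noteq> 0" "Poly_Mapping.lookup a q \<noteq> 0"
      using f unfolding edge_ideal_complete_graph by blast
    then obtain u where u: "u \<noteq> v" "Poly_Mapping.lookup a u \<noteq> 0"
      by metis
    have "Poly_Mapping.lookup a u \<le> vertex_weight (- {v}) a"
      unfolding vertex_weight_def by (rule member_le_sum) (use u in auto)
    then show "1 \<le> vertex_weight (- {v}) a" using u(2) by simp
  qed
qed

section \<open>Associated primes of the edge ideal\<close>

text \<open>The factor \<open>var v\<close> contributes the vertex \<open>v\<close>, so the second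
  vertex required by the edge ideal must come from outside \<open>v\<close>. This exhibits the prime
  as an annihilator.\<close>

lemma weight_ideal_eq_colon:
  "weight_ideal (- {v}) 1
   = {g :: ('v::finite, 'k::comm_ring_1) mpoly. g * var v \<in> edge_ideal complete_graph}"
proof -
  have "1 \<le> vertex_weight (- {v}) a \<longleftrightarrow>
      (\<exists>u w. u \<noteq> w \<and> Poly_Mapping.lookup (a + Poly_Mapping.single v 1) u \<noteq> 0
         \<and> Poly_Mapping.lookup (a + Poly_Mapping.single v 1) w \<noteq> 0)" for a :: "'v \<Rightarrow>\<^sub>0 nat"
  proof -
    have "1 \<le> vertex_weight (- {v}) a \<longleftrightarrow> vertex_weight (- {v}) a \<noteq> 0" by linarith
    also have "\<dots> \<longleftrightarrow> (\<exists>u. u \<noteq> v \<and> Poly_Mapping.lookup a u \<noteq> 0)"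
      unfolding vertex_weight_def by (subst sum_eq_0_iff) auto
    also have "\<dots> \<longleftrightarrow> (\<exists>u w. u \<noteq> w \<and> Poly_Mapping.lookup (a + Poly_Mapping.single v 1) u \<noteq> 0
         \<and> Poly_Mapping.lookup (a + Poly_Mapping.single v 1) w \<noteq> 0)"
    proof -
      have "Poly_Mapping.lookup (a + Poly_Mapping.single v 1) u \<noteq> 0
          \<longleftrightarrow> u = v \<or> Poly_Mapping.lookup a u \<noteq> 0" for u
        by (auto simp: lookup_add lookup_single when_def)
      then show ?thesis by metis
    qed
    finally show ?thesis .
  qed
  then show ?thesis
    by (simp add: weight_ideal_def edge_ideal_complete_graph var_def keys_mult_monomial)
qed

lemma weight_ideal_in_Ass:
  "weight_ideal (- {v}) 1 \<in> Ass (edge_ideal complete_graph :: ('v::{finite, linorder}, 'k::idom) mpoly set)"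
  unfolding Ass_def using prime_weight_ideal weight_ideal_eq_colon by blast

text \<open>If \<open>P\<close> contained every variable, then every product
  \<open>f * var v\<close> would lie in the edge ideal. This forces \<open>f\<close> itself into it,
  so that 1 would annihilate the class of \<open>f\<close>.\<close>

lemma Ass_edge_ideal_avoids_var:
  fixes P :: "('v::finite, 'k::comm_ring_1) mpoly set"
  assumes "P \<in> Ass (edge_ideal complete_graph)"
  obtains v where "var v \<notin> P"
proof (rule ccontr)
  assume "\<not> thesis"
  then have all: "var v \<in> P" for v using that by blast
  obtain f where P: "prime_ideal P" "P = {g. g * f \<in> edge_ideal complete_graph}"
    using assms by (auto simp: Ass_def)
  have "f \<in> edge_ideal complete_graph"
    unfolding edge_ideal_complete_graph
  proof clarify
    fix a assume a: "a \<in> Poly_Mapping.keys f"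
    have step: "\<exists>u w. u \<noteq> w \<and> Poly_Mapping.lookup (a + Poly_Mapping.single v 1) u \<noteq> 0
         \<and> Poly_Mapping.lookup (a + Poly_Mapping.single v 1) w \<noteq> 0" for v
    proof -
      have "f * var v \<in> edge_ideal complete_graph"
        using all[of v] P(2) by (simp add: mult.commute)
      then show ?thesis
        using a by (simp add: edge_ideal_complete_graph var_def keys_mult_monomial)
    qed
    \<comment> \<open>Any vertex would do for \<open>undefined\<close>: one extra variable cannot
      give a constant monomial two variables, so \<open>a\<close> is not zero.\<close>
    obtain u where u: "Poly_Mapping.lookup a u \<noteq> 0"
      using step[of undefined] by (auto simp: lookup_add lookup_single when_def split: if_splits)
    \<comment> \<open>Multiplying by the variable of \<open>u\<close>, already in the support of
      \<open>a\<close>, adds no new vertex; the two vertices found therefore belong to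
      \<open>a\<close>.\<close>
    show "\<exists>u w. u \<noteq> w \<and> Poly_Mapping.lookup a u \<noteq> 0 \<and> Poly_Mapping.lookup a w \<noteq> 0"
      using step[of u] u by (auto simp: lookup_add lookup_single when_def split: if_splits)
  qed
  then have "1 \<in> P" using P(2) by simp
  then show False using prime_idealD(1)[OF P(1)] by simp
qed

section \<open>Monomials in powers of the edge ideal\<close>

text \<open>Induction on \<open>t\<close>: the edge \<open>{u, w}\<close> removed joins a vertex of
  largest exponent to one of largest exponent among the rest. Only weights that count both endpoints
  drop by two, and these have slack.\<close>

lemma monomial_in_ideal_power:
  fixes a :: "'v::finite \<Rightarrow>\<^sub>0 nat"
  assumes "2 * t \<le> mon_degree a" "\<And>v. t \<le> vertex_weight (- {v}) a"
  shows "monomial a \<in> ideal_power (edge_ideal complete_graph :: ('v, 'k::comm_ring_1) mpoly set) t"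
  using assms
proof (induction t arbitrary: a)
  case 0
  show ?case by (simp add: ideal_power_0)
next
  case (Suc t)
  let ?l = "Poly_Mapping.lookup a"
  have "Max (range ?l) \<in> range ?l" by (rule Max_in) auto
  then obtain u where "?l u = Max (range ?l)" by (metis imageE)
  then have u: "?l v \<le> ?l u" for v by simp
  \<comment> \<open>The weight condition for \<open>u\<close> guarantees a second vertex in the
    support.\<close>
  have "\<exists>v \<in> - {u}. ?l v \<noteq> 0"
    using Suc.prems(2)[of u] by (auto simp: vertex_weight_def intro: ccontr)
  then obtain v0 where v0: "v0 \<noteq> u" "?l v0 \<noteq> 0" by blast
  then have "Max (?l ` (- {u})) \<in> ?l ` (- {u})" by (intro Max_in) auto
  then obtain w where w0: "w \<noteq> u" "?l w = Max (?l ` (- {u}))" by (metis imageE ComplD insertCI)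
  then have w: "?l v \<le> ?l w" if "v \<noteq> u" for v using that by simp
  have pos: "?l w \<noteq> 0" "?l u \<noteq> 0" using w[OF v0(1)] v0(2) u[of w] by auto
  obtain b where b: "a = (Poly_Mapping.single u 1 + Poly_Mapping.single w 1) + b"
    using split_two_variables[OF w0(1)[symmetric] pos(2) pos(1)] .
  have "2 * t \<le> mon_degree b"
    using Suc.prems(1) by (simp add: mon_degree_eq b vertex_weight_add vertex_weight_single)
  moreover have "t \<le> vertex_weight (- {v}) b" for v
  proof (cases "v = u \<or> v = w")
    case True
    then show ?thesis
      using Suc.prems(2)[of v] w0(1) by (auto simp: b vertex_weight_add vertex_weight_single)
  next
    case False
    then have vw: "vertex_weight (- {v}) a = vertex_weight (- {v}) b + 2"
      by (auto simp: b vertex_weight_add vertex_weight_single)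
    have "?l u + ?l w \<le> vertex_weight (- {v}) a"
      using sum_mono2[of "- {v}" "{u, w}" ?l] False w0(1) by (auto simp: vertex_weight_def)
    moreover have "?l v \<le> ?l w" using w False by blast
    moreover have "2 * t + 2 \<le> ?l v + vertex_weight (- {v}) a"
      using Suc.prems(1) by (simp add: mon_degree_split[of a v])
    \<comment> \<open>If the weight were at most \<open>t + 1\<close>, the exponent of
      \<open>v\<close> would be at least \<open>t + 1\<close>. Those of \<open>u\<close> and
      \<open>w\<close> would then add up to at least \<open>2 * t + 2\<close>, more than the
      weight.\<close>
    ultimately have "t + 2 \<le> vertex_weight (- {v}) a"
      using u[of v] by presburger
    then show ?thesis using vw by simp
  qed
  ultimately have "monomial b \<in> ideal_power (edge_ideal complete_graph :: ('v, 'k) mpoly set) t"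
    by (rule Suc.IH)
  then have "(var u * var w) * monomial b \<in> ideal_power (edge_ideal complete_graph :: ('v, 'k) mpoly set) (Suc t)"
    by (intro mult_in_ideal_power_Suc edge_in_edge_ideal w0(1)[symmetric])
  then show ?case by (simp add: b var_mult_var monomial_mult)
qed

section \<open>Minimal vertex covers of the complete graph\<close>

text \<open>Two vertices outside \<open>C\<close> would span an uncovered edge, so the complement of
  a cover has at most one vertex.\<close>

lemma vertex_cover_complete_graph:
  "vertex_cover complete_graph C \<longleftrightarrow> (\<exists>v. - {v} \<subseteq> C)"
proof
  assume C: "vertex_cover complete_graph C"
  show "\<exists>v. - {v} \<subseteq> C"
  proof (rule ccontr)
    assume "\<nexists>v. - {v} \<subseteq> C"
    then have ex: "\<exists>w. w \<noteq> v \<and> w \<notin> C" for v by (auto simp: subset_iff)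
    obtain u where u: "u \<notin> C" using ex[of undefined] by blast
    obtain w where w: "w \<noteq> u" "w \<notin> C" using ex[of u] by blast
    have "{u, w} \<in> complete_graph" using w(1) by (auto simp: complete_graph_def)
    then have "{u, w} \<inter> C \<noteq> {}" using C unfolding vertex_cover_def by (rule bspec[rotated])
    then show False using u w(2) by simp
  qed
next
  assume "\<exists>v. - {v} \<subseteq> C"
  then obtain v where v: "- {v} \<subseteq> C" ..
  show "vertex_cover complete_graph C"
    unfolding vertex_cover_def
  proof
    fix e :: "'a set" assume "e \<in> complete_graph"
    then obtain x y where "e = {x, y}" "x \<noteq> y" unfolding complete_graph_def by blast
    then show "e \<inter> C \<noteq> {}" using v by (cases "x = v") auto
  qed
qed

text \<open>The complements of single vertices are pairwise incomparable, so all of them are minimal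
  among the covers.\<close>

lemma minimal_vertex_cover_complete_graph:
  "minimal_vertex_cover complete_graph C \<longleftrightarrow> (\<exists>v. C = - {v})"
proof
  assume C: "minimal_vertex_cover complete_graph C"
  then obtain v where v: "- {v} \<subseteq> C"
    unfolding minimal_vertex_cover_def vertex_cover_complete_graph by (elim conjE exE)
  have "vertex_cover complete_graph (- {v})"
    unfolding vertex_cover_complete_graph by (rule exI) (rule subset_refl)
  then have "\<not> - {v} \<subset> C" using C unfolding minimal_vertex_cover_def by metis
  with v show "\<exists>v. C = - {v}" unfolding psubset_eq by metis
next
  assume "\<exists>v. C = - {v}"
  then obtain v where C: "C = - {v}" ..
  have "\<not> - {u} \<subseteq> C'" if C': "C' \<subset> - {v}" for u C'
  proof
    assume u: "- {u} \<subseteq> C'"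
    have "v \<notin> C'" using C' by auto
    then have "v = u" using u by auto
    then show False using u C' by simp
  qed
  then show "minimal_vertex_cover complete_graph C"
    unfolding minimal_vertex_cover_def vertex_cover_complete_graph C by (metis subset_refl)
qed

lemma D_set_complete_graph:
  "D_set complete_graph t = {monomial a | a. mon_degree a < 2 * t \<and> (\<forall>v. t \<le> vertex_weight (- {v}) a)}"
  by (auto simp: D_set_def minimal_vertex_cover_complete_graph)

section \<open>Symbolic powers\<close>

lemma symbolic_power_iff:
  "f \<in> symbolic_power I m \<longleftrightarrow> (\<forall>P\<in>Ass I. \<exists>s. s \<notin> P \<and> s * f \<in> ideal_power I m)"
  by (auto simp: symbolic_power_def Ass_def to_fract_in_extension_iff subspace_ideal_power)

lemma subspace_symbolic_power: "ideal.subspace (symbolic_power I m)"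
proof -
  have "symbolic_power I m = (\<Inter>P\<in>Ass I. {f. \<exists>s. s \<notin> P \<and> s * f \<in> ideal_power I m})"
    by (auto simp: symbolic_power_iff)
  also have "ideal.subspace \<dots>"
    by (intro ideal.subspace_Int subspace_saturation subspace_ideal_power) (simp add: Ass_def)
  finally show ?thesis .
qed

lemma ideal_power_subset_symbolic_power: "ideal_power I m \<subseteq> symbolic_power I m"
proof
  fix f assume "f \<in> ideal_power I m"
  then have "1 * f \<in> ideal_power I m" by simp
  then show "f \<in> symbolic_power I m"
    unfolding symbolic_power_iff Ass_def using prime_idealD(1) by blast
qed

text \<open>For a variable \<open>var v\<close> outside \<open>P\<close>, the multiplier
  \<open>var v ^ (2 * t)\<close> also avoids \<open>P\<close>. It raises the degree to at least
  \<open>2 * t\<close> and lowers no weight, so \<open>monomial_in_ideal_power\<close>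
  applies.\<close>

lemma D_set_subset_symbolic_power:
  "D_set complete_graph t
   \<subseteq> symbolic_power (edge_ideal complete_graph :: ('v::{finite, linorder}, 'k::idom) mpoly set) t"
proof
  fix f :: "('v, 'k) mpoly"
  assume "f \<in> D_set complete_graph t"
  then obtain a where f: "f = monomial a" and a: "\<And>v. t \<le> vertex_weight (- {v}) a"
    by (auto simp: D_set_complete_graph)
  show "f \<in> symbolic_power (edge_ideal complete_graph) t"
    unfolding symbolic_power_iff
  proof
    fix P :: "('v, 'k) mpoly set"
    assume P: "P \<in> Ass (edge_ideal complete_graph)"
    then obtain v where v: "var v \<notin> P" by (rule Ass_edge_ideal_avoids_var)
    have "var v ^ (2 * t) \<notin> P" using P v by (simp add: Ass_def prime_ideal_power)
    moreover have "monomial (Poly_Mapping.single v (2 * t) + a)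
        \<in> ideal_power (edge_ideal complete_graph :: ('v, 'k) mpoly set) t"
      by (rule monomial_in_ideal_power)
        (simp_all add: mon_degree_eq vertex_weight_add vertex_weight_single a trans_le_add2)
    then have "var v ^ (2 * t) * f \<in> ideal_power (edge_ideal complete_graph) t"
      by (simp add: f var_power monomial_mult)
    ultimately show "\<exists>s. s \<notin> P \<and> s * f \<in> ideal_power (edge_ideal complete_graph) t" by blast
  qed
qed

text \<open>At the associated prime \<open>weight_ideal (- {v}) 1\<close>, some \<open>s\<close>
  outside it carries \<open>f\<close> into the ordinary power, hence into
  \<open>weight_ideal (- {v}) t\<close>, and \<open>s\<close> can be cancelled.\<close>

lemma symbolic_power_subset_weight_ideal:
  "symbolic_power (edge_ideal complete_graph :: ('v::{finite, linorder}, 'k::idom) mpoly set) t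
   \<subseteq> weight_ideal (- {v}) t"
proof
  fix f :: "('v, 'k) mpoly"
  assume "f \<in> symbolic_power (edge_ideal complete_graph) t"
  then obtain s where "s \<notin> weight_ideal (- {v}) 1" "s * f \<in> ideal_power (edge_ideal complete_graph) t"
    using weight_ideal_in_Ass unfolding symbolic_power_iff by blast
  then show "f \<in> weight_ideal (- {v}) t"
    using ideal_power_subset_weight_ideal[OF edge_ideal_subset_weight_ideal] weight_ideal_cancel
    by blast
qed

theorem theorem6p4:
  fixes t :: nat
  assumes "t \<ge> 1"
  shows "symbolic_power
           (edge_ideal complete_graph :: ('v::{finite, linorder}, 'k::alg_closed_field) mpoly set) t
         = ideal_power (edge_ideal complete_graph) t + ideal.span (D_set complete_graph t)"
proof -
  let ?I = "edge_ideal complete_graph :: ('v, 'k) mpoly set"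
  let ?D = "D_set complete_graph t :: ('v, 'k) mpoly set"
  \<comment> \<open>A sum of ideals is generated by their union, so one inclusion follows from
    minimality of the span and the other can be checked on monomials.\<close>
  have sum_eq: "ideal_power ?I t + ideal.span ?D = ideal.span (ideal_power ?I t \<union> ?D)"
    by (auto simp: ideal.span_Un set_plus_def ideal.span_eq_iff[THEN iffD2, OF subspace_ideal_power])
  have "ideal.span (ideal_power ?I t \<union> ?D) \<subseteq> symbolic_power ?I t"
    by (intro ideal.span_minimal subspace_symbolic_power Un_least
        ideal_power_subset_symbolic_power D_set_subset_symbolic_power)
  moreover have "f \<in> ideal.span (ideal_power ?I t \<union> ?D)" if f: "f \<in> symbolic_power ?I t" for f
  proof (rule mem_subspace_if_monomials[OF ideal.subspace_span ideal.span_base])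
    fix a assume "a \<in> Poly_Mapping.keys f"
    then have weight: "t \<le> vertex_weight (- {v}) a" for v
      using f symbolic_power_subset_weight_ideal[of t v] by (auto simp: weight_ideal_def)
    show "monomial a \<in> ideal_power ?I t \<union> ?D"
    \<comment> \<open>The weight conditions hold in both cases; the degree alone decides between
      \<open>D_set\<close> and the ordinary power.\<close>
    proof (cases "mon_degree a < 2 * t")
      case True
      then show ?thesis using weight by (auto simp: D_set_complete_graph)
    next
      case False
      then show ?thesis using weight monomial_in_ideal_power[of t a] by auto
    qed
  qed
  ultimately show ?thesis unfolding sum_eq by blast
qed

end
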